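(* Let $a\neq 0$ be a constant, and let $\gamma$, $\lambda$, $\delta$ be arbitrary constants with $\lambda\gamma\neq 0$. The equation $$X\,Y''=Y'+a\,(Y')^3,\qquad Y=Y(X),$$ is mapped to the free particle equation $$W''=0,\qquad W=W(Z),$$ by the invertible point transformation $$Z=\frac{a\,Y^2+X^2}{2\gamma\,Y},\qquad W=\frac{\delta}{\lambda}-\frac{1}{2\gamma\lambda\,Y}.$$
   Context: Primes on $Y$ denote derivatives with respect to $X$; primes on $W$ denote derivatives with respect to $Z$. A point transformation is a change of the independent and dependent variables $(X,Y)\mapsto(Z,W)$ of the form $Z=\alpha(X,Y)$, $W=\beta(X,Y)$. *)

theory Defs
  imports "HOL-Analysis.Analysis"
begin

subsection \<open>Point transformations of the plane\<close>

type_synonym plane = "real \<times> real"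

definition point_transformation ::
    "(real \<Rightarrow> real \<Rightarrow> real) \<Rightarrow> (real \<Rightarrow> real \<Rightarrow> real) \<Rightarrow> plane \<Rightarrow> plane" where
  "point_transformation \<alpha> \<beta> = (\<lambda>(X, Y). (\<alpha> X Y, \<beta> X Y))"

text \<open>\<open>Ck_on k f D\<close> is meant for open \<open>D\<close>; \<open>fx\<close> and \<open>fy\<close> are the partial derivatives of \<open>f\<close>.\<close>

primrec Ck_on :: "nat \<Rightarrow> (plane \<Rightarrow> real) \<Rightarrow> plane set \<Rightarrow> bool" where
  "Ck_on 0 f D \<longleftrightarrow> continuous_on D f"
| "Ck_on (Suc k) f D \<longleftrightarrow>
     (\<exists>fx fy. (\<forall>p\<in>D. (f has_derivative (\<lambda>h. fx p * fst h + fy p * snd h)) (at p)) \<and>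
              Ck_on k fx D \<and> Ck_on k fy D)"

definition smooth_on :: "(plane \<Rightarrow> plane) \<Rightarrow> plane set \<Rightarrow> bool" where
  "smooth_on T D \<longleftrightarrow> (\<forall>k. Ck_on k (\<lambda>p. fst (T p)) D \<and> Ck_on k (\<lambda>p. snd (T p)) D)"

definition invertible_transformation_on :: "(plane \<Rightarrow> plane) \<Rightarrow> plane set \<Rightarrow> bool" where
  "invertible_transformation_on T D \<longleftrightarrow>
     open D \<and> inj_on T D \<and> open (T ` D) \<and>
     smooth_on T D \<and> smooth_on (inv_into D T) (T ` D)"

subsection \<open>Second-order ordinary differential equations\<close>

text \<open>An equation is a relation between \<open>x\<close>, \<open>y\<close>, \<open>y'\<close> and \<open>y''\<close>, in this order.\<close>

type_synonym ode2 = "real \<Rightarrow> real \<Rightarrow> real \<Rightarrow> real \<Rightarrow> bool"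

definition twice_differentiable_fun :: "real set \<Rightarrow> (real \<Rightarrow> real) \<Rightarrow> bool" where
  "twice_differentiable_fun I y \<longleftrightarrow>
     open I \<and> is_interval I \<and>
     (\<forall>x\<in>I. y differentiable (at x) \<and> deriv y differentiable (at x))"

definition solves_ode2 :: "ode2 \<Rightarrow> real set \<Rightarrow> (real \<Rightarrow> real) \<Rightarrow> bool" where
  "solves_ode2 E I y \<longleftrightarrow>
     twice_differentiable_fun I y \<and> (\<forall>x\<in>I. E x (y x) (deriv y x) (deriv (deriv y) x))"

definition graph_over :: "real set \<Rightarrow> (real \<Rightarrow> real) \<Rightarrow> plane set" where
  "graph_over I y = (\<lambda>x. (x, y x)) ` I"

subsection \<open>Mapping one equation to another\<close>

text \<open>
  A transformation acts on functions through their graphs.  The image of a graph is again a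
  graph as soon as the new independent variable has nonvanishing derivative along it (a curve
  sent to a vertical line does not define a function of the new independent variable).
\<close>

definition transforms_graphs :: "(plane \<Rightarrow> plane) \<Rightarrow> plane set \<Rightarrow> bool" where
  "transforms_graphs T D \<longleftrightarrow>
     (\<forall>I y. twice_differentiable_fun I y \<and> graph_over I y \<subseteq> D \<and>
            (\<forall>x\<in>I. deriv (\<lambda>t. fst (T (t, y t))) x \<noteq> 0) \<longrightarrow>
        (\<exists>J w. twice_differentiable_fun J w \<and> T ` graph_over I y = graph_over J w))"

text \<open>
  The first conjunct says that \<open>y\<close> solves \<open>E\<close> exactly if its transform \<open>w\<close> solves \<open>F\<close>; the
  other two guarantee that transforms exist, in both directions.
\<close>

definition maps_ode2 :: "(plane \<Rightarrow> plane) \<Rightarrow> plane set \<Rightarrow> ode2 \<Rightarrow> ode2 \<Rightarrow> bool" where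
  "maps_ode2 T D E F \<longleftrightarrow>
     (\<forall>I y J w. twice_differentiable_fun I y \<and> twice_differentiable_fun J w \<and>
                graph_over I y \<subseteq> D \<and> T ` graph_over I y = graph_over J w \<longrightarrow>
        (solves_ode2 E I y \<longleftrightarrow> solves_ode2 F J w)) \<and>
     transforms_graphs T D \<and> transforms_graphs (inv_into D T) (T ` D)"

end

(* Along a curve y = y(x) put N = a y^2 y' + 2 x y - x^2 y'.  The chain rule gives
   Z' = N / (2 gamma y^2) and w'(Z) = y' / (lam N).  Hence N never vanishes on a curve whose
   image is a graph, and differentiating once more,
   w''(Z) = 4 gamma y^3 (x y'' - y' - a y'^3) / (lam N^3).
   Transforms of graphs exist in both directions by the inverse function theorem, because the
   map and its inverse (the branch of sqrt with the sign s of X) are smooth. *)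

theory Submission
  imports Defs "HOL-Complex_Analysis.Conformal_Mappings"
begin

section \<open>Functions of class $C^k$ on the plane\<close>

lemma Ck_on_SucI:
  assumes "\<forall>p\<in>D. (f has_derivative (\<lambda>h. fx p * fst h + fy p * snd h)) (at p)"
    and "Ck_on k fx D" "Ck_on k fy D"
  shows "Ck_on (Suc k) f D"
  unfolding Ck_on.simps by (rule exI[of _ fx], rule exI[of _ fy]) (intro conjI assms)

text \<open>Differentiability gives continuity at the bottom of the induction. The lowering is
  needed because the partial derivatives of products, inverses and square roots contain the
  functions themselves, which must then be counted one order lower.\<close>

lemma Ck_on_Suc_imp_Ck_on: "Ck_on (Suc k) f D \<Longrightarrow> Ck_on k f D"
proof (induction k arbitrary: f)
  case 0
  then show ?case
    unfolding Ck_on.simps by (metis continuous_at_imp_continuous_on has_derivative_continuous)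
next
  case (Suc k)
  then obtain fx fy where
    "\<forall>p\<in>D. (f has_derivative (\<lambda>h. fx p * fst h + fy p * snd h)) (at p)"
    "Ck_on (Suc k) fx D" "Ck_on (Suc k) fy D"
    by (metis Ck_on.simps(2))
  then show ?case by (intro Ck_on_SucI[of D f fx fy] Suc.IH)
qed

text \<open>Near a point of an open set a derivative depends only on values inside that set, so the
  partial derivatives of \<open>f\<close> serve for \<open>g\<close> unchanged and a case
  distinction suffices. This later replaces an explicit inverse map by
  \<open>inv_into\<close>.\<close>

lemma Ck_on_cong:
  assumes "open D" and "\<And>p. p \<in> D \<Longrightarrow> f p = g p" and "Ck_on k f D"
  shows "Ck_on k g D"
proof (cases k)
  case 0
  with assms show ?thesis by (simp cong: continuous_on_cong)
next
  case (Suc n)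
  with assms(3) obtain fx fy where
    f: "\<forall>p\<in>D. (f has_derivative (\<lambda>h. fx p * fst h + fy p * snd h)) (at p)"
    and C: "Ck_on n fx D" "Ck_on n fy D" by auto
  have "\<forall>p\<in>D. (g has_derivative (\<lambda>h. fx p * fst h + fy p * snd h)) (at p)"
    using f assms(2) by (auto intro: has_derivative_transform_within_open[OF _ assms(1)])
  with C Suc show ?thesis by auto
qed

section \<open>Closure of the classes under arithmetic and square roots\<close>

lemma Ck_on_const: "Ck_on k (\<lambda>p. c) D"
proof (induction k arbitrary: c)
  case (Suc k)
  then show ?case by (auto intro!: exI[of _ "\<lambda>p. 0"])
qed simp

lemma Ck_on_fst: "Ck_on k fst D"
proof (cases k)
  case (Suc n)
  have "(fst has_derivative fst) (at p)" for p :: plane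
    by (intro bounded_linear_imp_has_derivative bounded_linear_fst)
  with Suc show ?thesis
    by (auto intro!: Ck_on_SucI[where fx="\<lambda>p. 1" and fy="\<lambda>p. 0"] Ck_on_const simp del: Ck_on.simps)
qed (auto intro!: continuous_intros)

lemma Ck_on_snd: "Ck_on k snd D"
proof (cases k)
  case (Suc n)
  have "(snd has_derivative snd) (at p)" for p :: plane
    by (intro bounded_linear_imp_has_derivative bounded_linear_snd)
  with Suc show ?thesis
    by (auto intro!: Ck_on_SucI[where fx="\<lambda>p. 0" and fy="\<lambda>p. 1"] Ck_on_const simp del: Ck_on.simps)
qed (auto intro!: continuous_intros)

lemma Ck_on_add:
  assumes "Ck_on k f D" "Ck_on k g D"
  shows "Ck_on k (\<lambda>p. f p + g p) D"
  using assms
proof (induction k arbitrary: f g)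
  case 0
  then show ?case by (auto intro!: continuous_intros)
next
  case (Suc k)
  from Suc.prems(1) obtain fx fy where
    f: "\<forall>p\<in>D. (f has_derivative (\<lambda>h. fx p * fst h + fy p * snd h)) (at p)"
       "Ck_on k fx D" "Ck_on k fy D" by auto
  from Suc.prems(2) obtain gx gy where
    g: "\<forall>p\<in>D. (g has_derivative (\<lambda>h. gx p * fst h + gy p * snd h)) (at p)"
       "Ck_on k gx D" "Ck_on k gy D" by auto
  have "\<forall>p\<in>D. ((\<lambda>p. f p + g p) has_derivative
          (\<lambda>h. (fx p + gx p) * fst h + (fy p + gy p) * snd h)) (at p)"
  proof
    fix p assume "p \<in> D"
    with f(1) g(1) show "((\<lambda>p. f p + g p) has_derivative
          (\<lambda>h. (fx p + gx p) * fst h + (fy p + gy p) * snd h)) (at p)"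
      by (auto intro!: derivative_eq_intros simp: algebra_simps)
  qed
  moreover have "Ck_on k (\<lambda>p. fx p + gx p) D" "Ck_on k (\<lambda>p. fy p + gy p) D"
    using Suc.IH f(2,3) g(2,3) by auto
  ultimately show ?case by (rule Ck_on_SucI)
qed

lemma Ck_on_mult:
  assumes "Ck_on k f D" "Ck_on k g D"
  shows "Ck_on k (\<lambda>p. f p * g p) D"
  using assms
proof (induction k arbitrary: f g)
  case 0
  then show ?case by (auto intro!: continuous_intros)
next
  case (Suc k)
  from Suc.prems(1) obtain fx fy where
    f: "\<forall>p\<in>D. (f has_derivative (\<lambda>h. fx p * fst h + fy p * snd h)) (at p)"
       "Ck_on k fx D" "Ck_on k fy D" by auto
  from Suc.prems(2) obtain gx gy where
    g: "\<forall>p\<in>D. (g has_derivative (\<lambda>h. gx p * fst h + gy p * snd h)) (at p)"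
       "Ck_on k gx D" "Ck_on k gy D" by auto
  note lower = Suc.prems[THEN Ck_on_Suc_imp_Ck_on]
  have "\<forall>p\<in>D. ((\<lambda>p. f p * g p) has_derivative
          (\<lambda>h. (f p * gx p + fx p * g p) * fst h + (f p * gy p + fy p * g p) * snd h)) (at p)"
  proof
    fix p assume "p \<in> D"
    with f(1) g(1) show "((\<lambda>p. f p * g p) has_derivative
          (\<lambda>h. (f p * gx p + fx p * g p) * fst h + (f p * gy p + fy p * g p) * snd h)) (at p)"
      by (auto intro!: derivative_eq_intros simp: algebra_simps)
  qed
  moreover have "Ck_on k (\<lambda>p. f p * gx p + fx p * g p) D"
    "Ck_on k (\<lambda>p. f p * gy p + fy p * g p) D"
    using Suc.IH f(2,3) g(2,3) lower by (auto intro!: Ck_on_add)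
  ultimately show ?case by (rule Ck_on_SucI)
qed

text \<open>The derivative -f'/f^2 involves only f' and 1/f at the lower order, so the induction
  closes through the product rule.\<close>

lemma Ck_on_inverse:
  assumes "Ck_on k f D" "\<forall>p\<in>D. f p \<noteq> 0"
  shows "Ck_on k (\<lambda>p. inverse (f p)) D"
  using assms(1)
proof (induction k)
  case 0
  with assms(2) show ?case by (auto intro!: continuous_intros)
next
  case (Suc k)
  from Suc.prems(1) obtain fx fy where
    f: "\<forall>p\<in>D. (f has_derivative (\<lambda>h. fx p * fst h + fy p * snd h)) (at p)"
       "Ck_on k fx D" "Ck_on k fy D" by auto
  note IH = Suc.IH[OF Ck_on_Suc_imp_Ck_on[OF Suc.prems]]
  \<comment> \<open>The sign is written as a constant factor so that \<open>Ck_on_mult\<close> and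
    \<open>Ck_on_const\<close> cover the whole expression.\<close>
  let ?c = "\<lambda>p. - 1 * (inverse (f p) * inverse (f p))"
  have "\<forall>p\<in>D. ((\<lambda>p. inverse (f p)) has_derivative
          (\<lambda>h. (?c p * fx p) * fst h + (?c p * fy p) * snd h)) (at p)"
  proof
    fix p assume "p \<in> D"
    with f(1) assms(2) show "((\<lambda>p. inverse (f p)) has_derivative
          (\<lambda>h. (?c p * fx p) * fst h + (?c p * fy p) * snd h)) (at p)"
      by (auto intro!: derivative_eq_intros simp: algebra_simps)
  qed
  moreover have "Ck_on k (\<lambda>p. ?c p * fx p) D" "Ck_on k (\<lambda>p. ?c p * fy p) D"
    by (intro Ck_on_mult Ck_on_const IH f(2,3))+
  ultimately show ?case by (rule Ck_on_SucI)
qed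

text \<open>The derivative is f'/(2 sqrt f): the induction hypothesis and
  \<open>Ck_on_inverse\<close> handle 1/sqrt f, where positivity keeps the root away from
  zero.\<close>

lemma Ck_on_sqrt:
  assumes "Ck_on k f D" "\<forall>p\<in>D. f p > 0"
  shows "Ck_on k (\<lambda>p. sqrt (f p)) D"
  using assms(1)
proof (induction k)
  case 0
  then show ?case by (auto intro!: continuous_intros)
next
  case (Suc k)
  from Suc.prems(1) obtain fx fy where
    f: "\<forall>p\<in>D. (f has_derivative (\<lambda>h. fx p * fst h + fy p * snd h)) (at p)"
       "Ck_on k fx D" "Ck_on k fy D" by auto
  note IH = Suc.IH[OF Ck_on_Suc_imp_Ck_on[OF Suc.prems]]
  let ?c = "\<lambda>p. 1 / 2 * inverse (sqrt (f p))"
  have "\<forall>p\<in>D. ((\<lambda>p. sqrt (f p)) has_derivative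
          (\<lambda>h. (?c p * fx p) * fst h + (?c p * fy p) * snd h)) (at p)"
  proof
    fix p assume "p \<in> D"
    with f(1) assms(2) show "((\<lambda>p. sqrt (f p)) has_derivative
          (\<lambda>h. (?c p * fx p) * fst h + (?c p * fy p) * snd h)) (at p)"
      by (auto intro!: derivative_eq_intros simp: field_simps)
  qed
  moreover have "Ck_on k (\<lambda>p. inverse (sqrt (f p))) D"
    using assms(2) by (intro Ck_on_inverse IH) auto
  then have "Ck_on k (\<lambda>p. ?c p * fx p) D" "Ck_on k (\<lambda>p. ?c p * fy p) D"
    by (intro Ck_on_mult Ck_on_const f(2,3); assumption)+
  ultimately show ?case by (rule Ck_on_SucI)
qed

section \<open>Transforms of graphs\<close>

text \<open>By the chain rule \<open>g\<close> is fx + fy y' along the graph. It is differentiable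
  because fx and fy are again differentiable along the graph and y' is differentiable.\<close>

lemma twice_differentiable_along_graph:
  assumes "Ck_on 2 f D" "twice_differentiable_fun I y" "graph_over I y \<subseteq> D"
  obtains g where "\<And>x. x \<in> I \<Longrightarrow> DERIV (\<lambda>t. f (t, y t)) x :> g x"
    and "\<And>x. x \<in> I \<Longrightarrow> g differentiable (at x)"
proof -
  \<comment> \<open>Stated for an arbitrary function, since it is applied to \<open>f\<close> and to
    both of its partial derivatives.\<close>
  have *: "DERIV (\<lambda>t. h (t, y t)) x :> hx (x, y x) + hy (x, y x) * deriv y x"
    if "\<forall>p\<in>D. (h has_derivative (\<lambda>k. hx p * fst k + hy p * snd k)) (at p)" "x \<in> I" for h hx hy x
  proof -
    have y: "(y has_derivative (\<lambda>t. deriv y x * t)) (at x)"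
      using assms(2) that(2)
      by (auto simp: twice_differentiable_fun_def field_differentiable_derivI
          DERIV_deriv_iff_real_differentiable simp flip: has_field_derivative_def)
    have "((\<lambda>t. (t, y t)) has_derivative (\<lambda>t. (t, deriv y x * t))) (at x)"
      by (intro has_derivative_Pair y has_derivative_ident)
    moreover have "(h has_derivative (\<lambda>k. hx (x, y x) * fst k + hy (x, y x) * snd k)) (at (x, y x))"
      using that assms(3) by (auto simp: graph_over_def)
    ultimately have "((\<lambda>t. h (t, y t)) has_derivative
        (\<lambda>t. hx (x, y x) * t + hy (x, y x) * (deriv y x * t))) (at x)"
      using has_derivative_compose by fastforce
    then show ?thesis
      by (rule has_derivative_imp_has_field_derivative) (simp add: algebra_simps)
  qed
  from assms(1) obtain fx fy where
    f: "\<forall>p\<in>D. (f has_derivative (\<lambda>h. fx p * fst h + fy p * snd h)) (at p)"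
    and C: "Ck_on 1 fx D" "Ck_on 1 fy D" by (auto simp: numeral_2_eq_2)
  from C(1) obtain fxx fxy where
    fx: "\<forall>p\<in>D. (fx has_derivative (\<lambda>h. fxx p * fst h + fxy p * snd h)) (at p)" by auto
  from C(2) obtain fyx fyy where
    fy: "\<forall>p\<in>D. (fy has_derivative (\<lambda>h. fyx p * fst h + fyy p * snd h)) (at p)" by auto
  have "(\<lambda>x. fx (x, y x) + fy (x, y x) * deriv y x) differentiable (at x)" if "x \<in> I" for x
    using *[OF fx that] *[OF fy that] assms(2) that
    by (intro differentiable_add differentiable_mult)
       (auto simp: twice_differentiable_fun_def real_differentiable_def)
  with *[OF f] show thesis by (rule that)
qed

text \<open>The functions \<open>deriv y\<close> and \<open>y'\<close> are known to agree only on
  \<open>I\<close>; openness of \<open>I\<close> lets the derivative of one pass to the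
  other.\<close>

lemma twice_differentiable_funI:
  assumes "open I" "is_interval I"
    and 1: "\<And>x. x \<in> I \<Longrightarrow> DERIV y x :> y' x"
    and 2: "\<And>x. x \<in> I \<Longrightarrow> y' differentiable (at x)"
  shows "twice_differentiable_fun I y"
  unfolding twice_differentiable_fun_def
proof (intro conjI ballI assms(1,2))
  fix x assume x: "x \<in> I"
  show "y differentiable (at x)" using 1[OF x] by (auto simp: real_differentiable_def)
  obtain d where d: "DERIV y' x :> d" using 2[OF x] by (auto simp: real_differentiable_def)
  have "DERIV (deriv y) x :> d"
    by (rule has_field_derivative_transform_within_open[OF d assms(1) x])
       (simp add: DERIV_imp_deriv[OF 1])
  then show "deriv y differentiable (at x)" by (auto simp: real_differentiable_def)
qed

text \<open>By the mean value theorem two equal values would force a zero of the derivative between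
  them.\<close>

lemma inj_on_of_deriv_nonzero:
  fixes f :: "real \<Rightarrow> real"
  assumes "is_interval I" and f: "\<And>x. x \<in> I \<Longrightarrow> DERIV f x :> f' x"
    and nz: "\<And>x. x \<in> I \<Longrightarrow> f' x \<noteq> 0"
  shows "inj_on f I"
proof (rule linorder_inj_onI')
  fix u v assume uv: "u \<in> I" "v \<in> I" "u < v"
  have sub: "x \<in> I" if "u \<le> x" "x \<le> v" for x
    using mem_is_interval_1_I[OF assms(1) uv(1,2) that] .
  show "f u \<noteq> f v"
  proof
    assume "f u = f v"
    then obtain z where "u < z" "z < v" "f v - f u = (v - u) * f' z"
      using MVT2[OF uv(3), of f f'] f[OF sub] by blast
    with \<open>f u = f v\<close> uv(3) nz[of z] sub[of z] show False by auto
  qed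
qed

text \<open>The new independent variable is injective along the curve, hence has a differentiable
  inverse \<open>h\<close> on its range \<open>J\<close>. The transform is the second component
  composed with \<open>h\<close>, with derivative the quotient g'/f' taken at
  \<open>h\<close>.\<close>

lemma transforms_graphs_of_smooth_on:
  assumes "smooth_on T D"
  shows "transforms_graphs T D"
  unfolding transforms_graphs_def
proof (intro allI impI, elim conjE)
  fix I y
  assume tw: "twice_differentiable_fun I y" and gr: "graph_over I y \<subseteq> D"
    and ne: "\<forall>x\<in>I. deriv (\<lambda>t. fst (T (t, y t))) x \<noteq> 0"
  let ?f = "\<lambda>t. fst (T (t, y t))" and ?g = "\<lambda>t. snd (T (t, y t))"
  have C: "Ck_on 2 (\<lambda>p. fst (T p)) D" "Ck_on 2 (\<lambda>p. snd (T p)) D"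
    using assms by (auto simp: smooth_on_def)
  obtain f' where f: "\<And>x. x \<in> I \<Longrightarrow> DERIV ?f x :> f' x"
    and f': "\<And>x. x \<in> I \<Longrightarrow> f' differentiable (at x)"
    using twice_differentiable_along_graph[OF C(1) tw gr] by blast
  obtain g' where g: "\<And>x. x \<in> I \<Longrightarrow> DERIV ?g x :> g' x"
    and g': "\<And>x. x \<in> I \<Longrightarrow> g' differentiable (at x)"
    using twice_differentiable_along_graph[OF C(2) tw gr] by blast
  have I: "open I" "is_interval I" using tw by (auto simp: twice_differentiable_fun_def)
  have nz: "f' x \<noteq> 0" if "x \<in> I" for x using ne f that by (metis DERIV_imp_deriv)
  have inj: "inj_on ?f I" using I(2) f nz by (rule inj_on_of_deriv_nonzero)
  have cont: "continuous_on I ?f" using f by (meson DERIV_isCont continuous_at_imp_continuous_on)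
  define J where "J = ?f ` I"
  define h where "h = inv_into I ?f"
  have hf: "h (?f x) = x" if "x \<in> I" for x using inv_into_f_f[OF inj that] by (simp add: h_def)
  \<comment> \<open>Openness comes from invariance of domain, the interval property from
    connectedness.\<close>
  have J: "open J" "is_interval J"
    unfolding J_def using invariance_of_domain[OF cont I(1) inj] I(2) cont
    by (auto simp: is_interval_connected_1 connected_continuous_image)
  have h: "DERIV h (?f x) :> inverse (f' x)" if "x \<in> I" for x
    using has_field_derivative_inverse_strong[OF f[OF that] nz[OF that] I(1) that cont] hf by blast
  define w where "w = (\<lambda>z. ?g (h z))"
  define w' where "w' = (\<lambda>z. g' (h z) * inverse (f' (h z)))"
  have "twice_differentiable_fun J w"
  proof (rule twice_differentiable_funI[OF J])
    fix z assume "z \<in> J"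
    then obtain x where x: "x \<in> I" "z = ?f x" by (auto simp: J_def)
    have hz: "h z = x" using x hf by simp
    have dh: "DERIV h z :> inverse (f' x)" using h x by simp
    show "DERIV w z :> w' z"
      unfolding w_def w'_def using DERIV_chain2[OF _ dh, of ?g "g' x"] g x(1) hz by simp
    have "(\<lambda>z. f' (h z)) differentiable (at z)" "(\<lambda>z. g' (h z)) differentiable (at z)"
      using f'[OF x(1)] g'[OF x(1)] dh hz DERIV_chain2[of _ _ h z]
      unfolding real_differentiable_def by blast+
    then show "w' differentiable (at z)"
      unfolding w'_def using nz[OF x(1)] hz
      by (intro differentiable_mult differentiable_inverse) auto
  qed
  moreover have "T ` graph_over I y = graph_over J w"
    unfolding graph_over_def J_def image_image
    by (intro image_cong) (auto simp: w_def hf prod_eq_iff)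
  ultimately show "\<exists>J w. twice_differentiable_fun J w \<and> T ` graph_over I y = graph_over J w"
    by blast
qed

text \<open>An explicit two-sided inverse \<open>G\<close> makes \<open>E\<close> the image of
  \<open>D\<close> and agrees there with \<open>inv_into D T\<close>, which inherits its
  smoothness.\<close>

lemma invertible_transformation_onI:
  assumes "open D" "open E"
    and "\<And>p. p \<in> D \<Longrightarrow> T p \<in> E" "\<And>p. p \<in> D \<Longrightarrow> G (T p) = p"
    and "\<And>q. q \<in> E \<Longrightarrow> G q \<in> D" "\<And>q. q \<in> E \<Longrightarrow> T (G q) = q"
    and "smooth_on T D" "smooth_on G E"
  shows "invertible_transformation_on T D"
proof -
  have inj: "inj_on T D" by (metis assms(4) inj_onI)
  have img: "T ` D = E" using assms(3,5,6) by force
  have "G q = inv_into D T q" if "q \<in> E" for q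
    using inj assms(5,6) that by (metis inv_into_f_f)
  then have "smooth_on (inv_into D T) E"
    using assms(8) unfolding smooth_on_def by (auto intro: Ck_on_cong[OF assms(2), rotated])
  then show ?thesis using assms inj img by (simp add: invertible_transformation_on_def)
qed

section \<open>The free particle\<close>

context
  fixes a \<gamma> lam \<delta> s :: real and T :: "plane \<Rightarrow> plane" and D :: "plane set"
  assumes \<gamma>: "\<gamma> \<noteq> 0" and lam: "lam \<noteq> 0" and s: "s = 1 \<or> s = - 1"
  defines "T \<equiv> point_transformation
                  (\<lambda>X Y. (a * Y^2 + X^2) / (2 * \<gamma> * Y))
                  (\<lambda>X Y. \<delta> / lam - 1 / (2 * \<gamma> * lam * Y))"
    and "D \<equiv> {(X, Y). s * X > 0 \<and> Y \<noteq> 0}"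
begin

text \<open>Solving for W yields Y, and then Z yields only X^2: points (X, Y) and (-X, Y) have the
  same image, so the sign \<open>s\<close> must select the root.\<close>

lemma T_invertible: "invertible_transformation_on T D"
proof -
  \<comment> \<open>\<open>V\<close> is 1/Y and \<open>R\<close> is X^2 in the new coordinates,
    written with the operations of the closure lemmas. In \<open>E\<close> the second condition says
    that \<open>R\<close> is positive, as R V^2 = 2 gamma Z V - a.\<close>
  define V where "V = (\<lambda>q::plane. 2 * \<gamma> * \<delta> + (- 2 * \<gamma> * lam) * snd q)"
  define R where "R = (\<lambda>q::plane. (2 * \<gamma>) * (fst q * inverse (V q)) +
      (- a) * (inverse (V q) * inverse (V q)))"
  define G where "G = (\<lambda>q::plane. (s * sqrt (R q), inverse (V q)))"
  define E where "E = {q::plane. V q \<noteq> 0 \<and> 2 * \<gamma> * fst q * V q > a}"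
  have R: "R q = (2 * \<gamma> * fst q * V q - a) * (inverse (V q))\<^sup>2" if "V q \<noteq> 0" for q
    using that by (simp add: R_def power2_eq_square field_simps)
  have Rpos: "R q > 0" if "q \<in> E" for q using that by (simp add: R E_def)
  have VT: "V (T (X, Y)) = inverse Y" if "Y \<noteq> 0" for X Y
    using that \<gamma> lam by (simp add: V_def T_def point_transformation_def field_simps)
  have ZT: "2 * \<gamma> * fst (T (X, Y)) = (a * Y^2 + X^2) / Y" if "Y \<noteq> 0" for X Y
    using that \<gamma> by (simp add: T_def point_transformation_def field_simps)
  have RT: "R (T (X, Y)) = X\<^sup>2" if "Y \<noteq> 0" for X Y
    using R[of "T (X, Y)"] that unfolding VT[OF that] ZT[OF that]
    by (simp add: power2_eq_square field_simps)
  have sX: "s * \<bar>X\<bar> = X" if "s * X > 0" for X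
    using s that by auto
  show ?thesis
  proof (rule invertible_transformation_onI)
    show "open D"
      unfolding D_def case_prod_beta by (intro open_Collect_conj open_Collect_less open_Collect_neq continuous_intros)
    show "open E"
      unfolding E_def V_def by (intro open_Collect_conj open_Collect_less open_Collect_neq continuous_intros)
    show "T p \<in> E" if "p \<in> D" for p
    proof -
      obtain X Y where p: "p = (X, Y)" "s * X > 0" "Y \<noteq> 0" using \<open>p \<in> D\<close> by (auto simp: D_def)
      have "X \<noteq> 0" using p by auto
      \<comment> \<open>On the image 2 gamma Z V equals a + (X/Y)^2, which exceeds a.\<close>
      then have "0 < (X / Y)\<^sup>2" using p(3) by simp
      moreover have "(a * Y^2 + X^2) / Y * inverse Y = a + (X / Y)\<^sup>2"
        using p(3) by (simp add: power2_eq_square field_simps)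
      ultimately show ?thesis
        using p(3) unfolding E_def p(1) mem_Collect_eq VT[OF p(3)] ZT[OF p(3)] by simp
    qed
    show "G (T p) = p" if "p \<in> D" for p
      using that by (auto simp: D_def G_def VT RT sX)
    show "G q \<in> D" if "q \<in> E" for q
      using that Rpos[OF that] s by (auto simp: D_def G_def E_def)
    show "T (G q) = q" if "q \<in> E" for q
    proof -
      have V: "V q \<noteq> 0" using that by (simp add: E_def)
      have "(s * sqrt (R q))\<^sup>2 = R q" using Rpos[OF that] s by (auto simp: power_mult_distrib)
      then have "fst (T (G q)) = (a * (inverse (V q))\<^sup>2 + R q) / (2 * \<gamma> * inverse (V q))"
        by (simp add: T_def point_transformation_def G_def)
      also have "\<dots> = fst q" using V \<gamma> by (simp add: R power2_eq_square field_simps)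
      finally have 1: "fst (T (G q)) = fst q" .
      have "snd (T (G q)) = \<delta> / lam - V q / (2 * \<gamma> * lam)"
        by (simp add: T_def point_transformation_def G_def field_simps)
      also have "\<dots> = snd q" using \<gamma> lam by (simp add: V_def field_simps)
      finally show ?thesis using 1 by (simp add: prod_eq_iff)
    qed
    have inv: "Ck_on k (\<lambda>p. inverse (c * snd p)) D" if "c \<noteq> 0" for k c
      using that by (intro Ck_on_inverse Ck_on_mult Ck_on_const Ck_on_snd) (auto simp: D_def)
    \<comment> \<open>The components of \<open>T\<close> in a shape that matches the closure lemmas;
      the two equations below identify them with \<open>T\<close>.\<close>
    have "Ck_on k (\<lambda>p. (a * (snd p * snd p) + fst p * fst p) * inverse ((2 * \<gamma>) * snd p)) D"
         "Ck_on k (\<lambda>p. \<delta> / lam + (- 1) * inverse ((2 * \<gamma> * lam) * snd p)) D" for k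
      by (intro Ck_on_add Ck_on_mult Ck_on_const Ck_on_fst Ck_on_snd inv; use \<gamma> lam in simp)+
    moreover have
      "fst (T p) = (a * (snd p * snd p) + fst p * fst p) * inverse ((2 * \<gamma>) * snd p)" for p
      unfolding T_def point_transformation_def case_prod_beta power2_eq_square divide_inverse fst_conv
      by (rule refl)
    moreover have "snd (T p) = \<delta> / lam + (- 1) * inverse ((2 * \<gamma> * lam) * snd p)" for p
      unfolding T_def point_transformation_def case_prod_beta snd_conv
      by (simp only: inverse_eq_divide diff_conv_add_uminus mult_minus_left mult_1)
    ultimately show "smooth_on T D"
      unfolding smooth_on_def by (simp only: simp_thms)
    have V: "Ck_on k V E" for k unfolding V_def by (intro Ck_on_add Ck_on_mult Ck_on_const Ck_on_snd)
    have "Ck_on k (\<lambda>q. inverse (V q)) E" for k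
      by (intro Ck_on_inverse V) (auto simp: E_def)
    moreover from this have "Ck_on k R E" for k
      unfolding R_def by (intro Ck_on_add Ck_on_mult Ck_on_const Ck_on_fst)
    then have "Ck_on k (\<lambda>q. s * sqrt (R q)) E" for k
      using Rpos by (intro Ck_on_mult Ck_on_const Ck_on_sqrt) auto
    ultimately show "smooth_on G E" by (simp add: smooth_on_def G_def)
  qed
qed

lemma T_solution_iff:
  assumes y: "twice_differentiable_fun I y" and w: "twice_differentiable_fun J w"
    and gr: "graph_over I y \<subseteq> D" and img: "T ` graph_over I y = graph_over J w"
  shows "solves_ode2 (\<lambda>X Y Y' Y''. X * Y'' = Y' + a * Y'^3) I y \<longleftrightarrow>
         solves_ode2 (\<lambda>Z W W' W''. W'' = 0) J w"
proof -
  define z where "z = (\<lambda>x. (a * (y x)^2 + x^2) / (2 * \<gamma> * y x))"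
  define N where "N = (\<lambda>x. a * (y x)\<^sup>2 * deriv y x + 2 * x * y x - x\<^sup>2 * deriv y x)"
  have T: "T (x, y x) = (z x, \<delta> / lam - 1 / (2 * \<gamma> * lam * y x))" for x
    by (simp add: T_def point_transformation_def z_def)
  \<comment> \<open>Comparing first coordinates in \<open>img\<close> turns statements over
    \<open>J\<close> into statements over \<open>I\<close>.\<close>
  have J: "J = z ` I"
    using arg_cong[OF img, of "(`) fst"] by (simp add: graph_over_def image_image T)
  have wz: "w (z x) = \<delta> / lam - 1 / (2 * \<gamma> * lam * y x)" if "x \<in> I" for x
  proof -
    have "T (x, y x) \<in> graph_over J w" using that img by (auto simp: graph_over_def)
    then show ?thesis by (auto simp: T graph_over_def)
  qed
  have I: "open I" using y by (simp add: twice_differentiable_fun_def)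
  have nz: "x \<noteq> 0" "y x \<noteq> 0" if "x \<in> I" for x
    using that gr by (auto simp: graph_over_def D_def)
  have dy: "DERIV y x :> deriv y x" "DERIV (deriv y) x :> deriv (deriv y) x" if "x \<in> I" for x
    using that y by (auto simp: twice_differentiable_fun_def DERIV_deriv_iff_real_differentiable)
  have dw: "DERIV w (z x) :> deriv w (z x)" "DERIV (deriv w) (z x) :> deriv (deriv w) (z x)"
    if "x \<in> I" for x
    using that w J by (auto simp: twice_differentiable_fun_def DERIV_deriv_iff_real_differentiable)
  have dz: "DERIV z x :> N x / (2 * \<gamma> * (y x)\<^sup>2)" if "x \<in> I" for x
    unfolding z_def N_def using nz[OF that] \<gamma>
    by (auto intro!: derivative_eq_intros dy(1)[OF that] simp: divide_simps)
       (simp add: algebra_simps power2_eq_square)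
  \<comment> \<open>Two derivatives of w(z(x)) are compared, one from the chain rule and one from
    the explicit formula. The result stays in product form because N nonzero is deduced from
    it.\<close>
  have 1: "deriv w (z x) * N x = deriv y x / lam" if "x \<in> I" for x
  proof -
    have "DERIV (\<lambda>t. w (z t)) x :> deriv w (z x) * (N x / (2 * \<gamma> * (y x)\<^sup>2))"
      by (rule DERIV_chain2[OF dw(1)[OF that] dz[OF that]])
    moreover have "DERIV (\<lambda>t. \<delta> / lam - 1 / (2 * \<gamma> * lam * y t)) x :>
        deriv y x / (2 * \<gamma> * lam * (y x)\<^sup>2)"
      using nz[OF that] \<gamma> lam
      by (auto intro!: derivative_eq_intros dy(1)[OF that] simp: power2_eq_square)
    then have "DERIV (\<lambda>t. w (z t)) x :> deriv y x / (2 * \<gamma> * lam * (y x)\<^sup>2)"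
      by (rule has_field_derivative_transform_within_open[OF _ I that]) (simp add: wz)
    ultimately have "deriv w (z x) * (N x / (2 * \<gamma> * (y x)\<^sup>2)) =
        deriv y x / (2 * \<gamma> * lam * (y x)\<^sup>2)"
      by (rule DERIV_unique)
    then show ?thesis using nz[OF that] \<gamma> lam by (simp add: field_simps)
  qed
  \<comment> \<open>The transform has no vertical tangent: if \<open>N x = 0\<close>, then \<open>y' x = 0\<close> by the
    relation just proved, and hence \<open>N x = 2 x y\<close>, which is nonzero.\<close>
  have N: "N x \<noteq> 0" if "x \<in> I" for x
    using 1[OF that] nz[OF that] lam by (auto simp: N_def)
  \<comment> \<open>The same comparison one order higher: y'/(lam N) may now be differentiated,
    since N has no zero on \<open>I\<close>.\<close>
  have 2: "deriv (deriv w) (z x) * (lam * N x ^ 3) =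
      4 * \<gamma> * (y x)^3 * (x * deriv (deriv y) x - (deriv y x + a * (deriv y x)^3))"
    if "x \<in> I" for x
  proof -
    let ?y = "y x" and ?y' = "deriv y x" and ?y'' = "deriv (deriv y) x"
    \<comment> \<open>The terms 2 x y' from the last two summands of N cancel.\<close>
    let ?N' = "2 * a * ?y * ?y'\<^sup>2 + a * ?y\<^sup>2 * ?y'' + 2 * ?y - x\<^sup>2 * ?y''"
    have dN: "DERIV N x :> ?N'"
      unfolding N_def
      by (auto intro!: derivative_eq_intros dy[OF that] simp: algebra_simps power2_eq_square)
    have "DERIV (\<lambda>t. deriv y t / (lam * N t)) x :> (?y'' * N x - ?y' * ?N') / (lam * (N x)\<^sup>2)"
      using N[OF that] lam
      by (auto intro!: derivative_eq_intros dy[OF that] dN simp: divide_simps)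
         (simp add: algebra_simps power2_eq_square)
    then have "DERIV (\<lambda>t. deriv w (z t)) x :> (?y'' * N x - ?y' * ?N') / (lam * (N x)\<^sup>2)"
    proof (rule has_field_derivative_transform_within_open[OF _ I that])
      fix t assume t: "t \<in> I"
      show "deriv y t / (lam * N t) = deriv w (z t)" using 1[OF t] N[OF t] lam by (simp add: field_simps)
    qed
    moreover have "DERIV (\<lambda>t. deriv w (z t)) x :> deriv (deriv w) (z x) * (N x / (2 * \<gamma> * ?y\<^sup>2))"
      by (rule DERIV_chain2[OF dw(2)[OF that] dz[OF that]])
    ultimately have eq: "deriv (deriv w) (z x) * (N x / (2 * \<gamma> * ?y\<^sup>2)) =
        (?y'' * N x - ?y' * ?N') / (lam * (N x)\<^sup>2)"
      by (rule DERIV_unique[rotated])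
    \<comment> \<open>All terms containing the product y' y'' cancel, leaving 2 y times the residual
      of the original equation.\<close>
    have "?y'' * N x - ?y' * ?N' = 2 * ?y * (x * ?y'' - (?y' + a * ?y'^3))"
      by (simp add: N_def algebra_simps power2_eq_square power3_eq_cube)
    with eq have "deriv (deriv w) (z x) * (N x / (2 * \<gamma> * ?y\<^sup>2)) =
        2 * ?y * (x * ?y'' - (?y' + a * ?y'^3)) / (lam * (N x)\<^sup>2)" by simp
    then show ?thesis
      using N[OF that] lam \<gamma> nz[OF that]
      by (simp add: divide_simps) (simp add: algebra_simps power2_eq_square power3_eq_cube)
  qed
  \<comment> \<open>In relation \<open>2\<close> the factors lam N^3 and 4 gamma y^3 are nonzero, so
    both residuals vanish at the same points.\<close>
  have "x * deriv (deriv y) x = deriv y x + a * (deriv y x)^3 \<longleftrightarrow> deriv (deriv w) (z x) = 0"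
    if "x \<in> I" for x
    using 2[OF that] N[OF that] nz[OF that] lam \<gamma> by auto
  then show ?thesis using y w by (auto simp: solves_ode2_def J)
qed

lemma T_maps_to_free_particle:
  "invertible_transformation_on T D \<and>
   maps_ode2 T D (\<lambda>X Y Y' Y''. X * Y'' = Y' + a * Y'^3) (\<lambda>Z W W' W''. W'' = 0)"
proof -
  have "transforms_graphs T D" "transforms_graphs (inv_into D T) (T ` D)"
    using T_invertible unfolding invertible_transformation_on_def
    by (blast intro: transforms_graphs_of_smooth_on)+
  then show ?thesis
    unfolding maps_ode2_def using T_invertible T_solution_iff by blast
qed

end

theorem mainTheorem3:
  fixes a \<gamma> lam \<delta> :: real
  assumes "a \<noteq> 0" and "lam * \<gamma> \<noteq> 0"
  defines "T \<equiv> point_transformation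
                  (\<lambda>X Y. (a * Y^2 + X^2) / (2 * \<gamma> * Y))
                  (\<lambda>X Y. \<delta> / lam - 1 / (2 * \<gamma> * lam * Y))"
  shows "\<forall>D \<in> {{(X, Y). X > 0 \<and> Y \<noteq> 0}, {(X, Y). X < 0 \<and> Y \<noteq> 0}}.
           invertible_transformation_on T D \<and>
           maps_ode2 T D
             (\<lambda>X Y Y' Y''. X * Y'' = Y' + a * Y'^3)
             (\<lambda>Z W W' W''. W'' = 0)"
proof -
  \<comment> \<open>The two half-planes are the cases \<open>s = 1\<close> and
    \<open>s = - 1\<close> of the preceding context.\<close>
  have D: "{(X::real, Y::real). X > 0 \<and> Y \<noteq> 0} = {(X, Y). 1 * X > 0 \<and> Y \<noteq> 0}"
    "{(X::real, Y::real). X < 0 \<and> Y \<noteq> 0} = {(X, Y). - 1 * X > 0 \<and> Y \<noteq> 0}"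
    by auto
  have nz: "\<gamma> \<noteq> 0" "lam \<noteq> 0"
    using assms(2) by auto
  show ?thesis
    unfolding D T_def
    using T_maps_to_free_particle[OF nz disjI1[OF refl], of a \<delta>]
      T_maps_to_free_particle[OF nz disjI2[OF refl], of a \<delta>]
    by (simp only: ball_simps simp_thms)
qed

end
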